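(* Let $\mu_1,\mu_2\in\mathbb R$ and let $B_1^{\mu_1}$, $B_2^{\mu_2}$ be two independent Brownian motions with drifts $\mu_1$ and $\mu_2$, both started at $0$. For $t>0$ let $${}^{\mu_1}_{\mu_2}T_{0,t}=\sup\Big\{s<\max_{0\le z\le t}|B_2^{\mu_2}(z)|:B_1^{\mu_1}(s)=0\Big\},$$ and for $w>0$ let ${}^{\mu_1}T_{0,w}=\sup\{s<w:B_1^{\mu_1}(s)=0\}$. Then for every $a>0$, $$P({}^{\mu_1}_{\mu_2}T_{0,t}<a)=P\Big(\max_{0\le z\le t}|B_2^{\mu_2}(z)|<a\Big)+\int_a^\infty P({}^{\mu_1}T_{0,w}<a)\,P\Big(\max_{0\le z\le t}|B_2^{\mu_2}(z)|\in dw\Big).$$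
   Context: A Brownian motion with drift $\mu$ started at $0$ is $B^\mu(s)=B(s)+\mu s$, $s\ge 0$, with $B$ a standard one-dimensional Brownian motion, $B(0)=0$. Suprema are over $s\ge0$. $P(\max_{0\le z\le t}|B_2^{\mu_2}(z)|\in dw)$ denotes integration against the law of $\max_{0\le z\le t}|B_2^{\mu_2}(z)|$. *)

theory Defs
  imports "HOL-Probability.Probability"
begin

text \<open>
  Processes are functions of time and sample point; only times \<open>s \<ge> 0\<close> are relevant.
  All sample paths (not just almost all) start at 0 and are continuous, so that the events
  below are measurable without completing the probability space.
\<close>

definition standard_brownian_motion :: "'a measure \<Rightarrow> (real \<Rightarrow> 'a \<Rightarrow> real) \<Rightarrow> bool" where
  "standard_brownian_motion M B \<longleftrightarrow>
     prob_space M \<and>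
     (\<forall>s\<ge>0. B s \<in> borel_measurable M) \<and>
     (\<forall>\<omega>\<in>space M. B 0 \<omega> = 0) \<and>
     (\<forall>\<omega>\<in>space M. continuous_on {0..} (\<lambda>s. B s \<omega>)) \<and>
     (\<forall>s t. 0 \<le> s \<and> s < t \<longrightarrow>
        distributed M lborel (\<lambda>\<omega>. B t \<omega> - B s \<omega>) (normal_density 0 (sqrt (t - s)))) \<and>
     (\<forall>n (\<tau> :: nat \<Rightarrow> real). 0 \<le> \<tau> 0 \<and> (\<forall>i<n. \<tau> i \<le> \<tau> (Suc i)) \<longrightarrow>
        prob_space.indep_vars M (\<lambda>_. borel) (\<lambda>i \<omega>. B (\<tau> (Suc i)) \<omega> - B (\<tau> i) \<omega>) {..<n})"

definition with_drift :: "real \<Rightarrow> (real \<Rightarrow> 'a \<Rightarrow> real) \<Rightarrow> real \<Rightarrow> 'a \<Rightarrow> real" where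
  "with_drift \<mu> B s \<omega> = B s \<omega> + \<mu> * s"

text \<open>
  Independence of whole processes, i.e. of the \<open>\<sigma>\<close>-algebras generated by all coordinates
  at times \<open>s \<ge> 0\<close>.
\<close>

definition indep_processes ::
    "'a measure \<Rightarrow> (real \<Rightarrow> 'a \<Rightarrow> real) \<Rightarrow> (real \<Rightarrow> 'a \<Rightarrow> real) \<Rightarrow> bool" where
  "indep_processes M X Y \<longleftrightarrow>
     prob_space.indep_var M
       (\<Pi>\<^sub>M s\<in>{0::real..}. borel) (\<lambda>\<omega>. \<lambda>s\<in>{0..}. X s \<omega>)
       (\<Pi>\<^sub>M s\<in>{0::real..}. borel) (\<lambda>\<omega>. \<lambda>s\<in>{0..}. Y s \<omega>)"

text \<open>For continuous paths and \<open>t \<ge> 0\<close> the supremum is attained.\<close>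

definition max_abs :: "(real \<Rightarrow> 'a \<Rightarrow> real) \<Rightarrow> real \<Rightarrow> 'a \<Rightarrow> real" where
  "max_abs X t \<omega> = (SUP z\<in>{0..t}. \<bar>X z \<omega>\<bar>)"

definition last_zero_before :: "(real \<Rightarrow> 'a \<Rightarrow> real) \<Rightarrow> real \<Rightarrow> 'a \<Rightarrow> real" where
  "last_zero_before X w \<omega> = Sup {s. 0 \<le> s \<and> s < w \<and> X s \<omega> = 0}"

definition last_zero_before_max ::
    "(real \<Rightarrow> 'a \<Rightarrow> real) \<Rightarrow> (real \<Rightarrow> 'a \<Rightarrow> real) \<Rightarrow> real \<Rightarrow> 'a \<Rightarrow> real" where
  "last_zero_before_max X Y t \<omega> = Sup {s. 0 \<le> s \<and> s < max_abs Y t \<omega> \<and> X s \<omega> = 0}"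

end

(* On {0 < W < a}, where W is the maximum of the second process, the last zero before W is at
   most W < a; on {W >= a} it is the last zero of the first process before an independent level,
   so conditioning on W (Fubini) gives the integral.  The event {W = 0}, where the set of zeros
   is empty, is null because B_2(t) has a density. *)
theory Submission
  imports Defs
begin

section \<open>Zeros of a path expressed through rational times\<close>

text \<open>A supremum strictly below \<open>a\<close> leaves a gap, and any rational
  \<open>b\<close> in that gap bounds all zeros. The bound must be strictly smaller than
  \<open>a\<close>, since zeros could accumulate at \<open>a\<close> from below. As
  \<open>0 < a \<le> w\<close>, time 0 is one of the zeros, so the supremum is over a nonempty
  set.\<close>

lemma last_zero_before_less_iff:
  assumes "X 0 \<omega> = 0" and "0 < a" and "a \<le> w"
  shows "last_zero_before X w \<omega> < a \<longleftrightarrow> (\<exists>b\<in>\<rat>. 0 < b \<and> b < a \<and> (\<forall>s\<in>{b..<w}. X s \<omega> \<noteq> 0))"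
proof -
  let ?Z = "{s. 0 \<le> s \<and> s < w \<and> X s \<omega> = 0}"
  have zero: "0 \<in> ?Z" using assms by auto
  have bdd: "bdd_above ?Z" by (rule bdd_aboveI[of _ w]) auto
  show ?thesis
  proof
    assume L: "last_zero_before X w \<omega> < a"
    \<comment> \<open>This makes the chosen \<open>b\<close> positive, so that
      \<open>{b..<w}\<close> lies in the range of admissible times.\<close>
    have "0 \<le> Sup ?Z" using cSup_upper[OF zero bdd] .
    moreover obtain b where b: "b \<in> \<rat>" "Sup ?Z < b" "b < a"
      using L Rats_dense_in_real unfolding last_zero_before_def by blast
    moreover have "X s \<omega> \<noteq> 0" if "s \<in> {b..<w}" for s
    proof
      assume "X s \<omega> = 0"
      then have "s \<in> ?Z" using that b \<open>0 \<le> Sup ?Z\<close> by auto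
      then show False using cSup_upper[OF _ bdd, of s] b that by auto
    qed
    ultimately show "\<exists>b\<in>\<rat>. 0 < b \<and> b < a \<and> (\<forall>s\<in>{b..<w}. X s \<omega> \<noteq> 0)"
      by (intro bexI[of _ b]) auto
  next
    assume "\<exists>b\<in>\<rat>. 0 < b \<and> b < a \<and> (\<forall>s\<in>{b..<w}. X s \<omega> \<noteq> 0)"
    then obtain b where b: "b < a" "\<forall>s\<in>{b..<w}. X s \<omega> \<noteq> 0" by auto
    have "Sup ?Z \<le> b"
    proof (rule cSup_least)
      show "?Z \<noteq> {}" using zero by auto
      show "s \<le> b" if "s \<in> ?Z" for s
        using that b by (metis (mono_tags, lifting) atLeastLessThan_iff linorder_le_cases mem_Collect_eq)
    qed
    then show "last_zero_before X w \<omega> < a" using b by (simp add: last_zero_before_def)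
  qed
qed

text \<open>On each compact \<open>{b..q}\<close> a nowhere vanishing continuous function is bounded
  away from 0, and that bound can be tested at rational points. The exhaustion by
  \<open>q < w\<close> is essential because \<open>f\<close> may vanish at \<open>w\<close>
  itself.\<close>

lemma nonvanishing_iff_bounded_on_rationals:
  fixes f :: "real \<Rightarrow> real"
  assumes "continuous_on {0..} f" and "0 \<le> b"
  shows "(\<forall>s\<in>{b..<w}. f s \<noteq> 0) \<longleftrightarrow>
    (\<forall>q\<in>\<rat>. b < q \<and> q < w \<longrightarrow> (\<exists>n. \<forall>r\<in>\<rat> \<inter> {b..q}. 1 / real (Suc n) \<le> \<bar>f r\<bar>))"
proof
  assume nz: "\<forall>s\<in>{b..<w}. f s \<noteq> 0"
  show "\<forall>q\<in>\<rat>. b < q \<and> q < w \<longrightarrow> (\<exists>n. \<forall>r\<in>\<rat> \<inter> {b..q}. 1 / real (Suc n) \<le> \<bar>f r\<bar>)"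
  proof (intro ballI impI)
    fix q assume q: "b < q \<and> q < w"
    have "continuous_on {b..q} (\<lambda>s. \<bar>f s\<bar>)"
      by (intro continuous_intros continuous_on_subset[OF assms(1)]) (use assms(2) in auto)
    then obtain x where x: "x \<in> {b..q}" "\<forall>y\<in>{b..q}. \<bar>f x\<bar> \<le> \<bar>f y\<bar>"
      using continuous_attains_inf[of "{b..q}" "\<lambda>s. \<bar>f s\<bar>"] q by auto
    have "0 < \<bar>f x\<bar>" using nz x q by auto
    then obtain n where "1 / real (Suc n) < \<bar>f x\<bar>" using nat_approx_posE by blast
    then show "\<exists>n. \<forall>r\<in>\<rat> \<inter> {b..q}. 1 / real (Suc n) \<le> \<bar>f r\<bar>"
      using x by (intro exI[of _ n]) force
  qed
next
  assume bd: "\<forall>q\<in>\<rat>. b < q \<and> q < w \<longrightarrow> (\<exists>n. \<forall>r\<in>\<rat> \<inter> {b..q}. 1 / real (Suc n) \<le> \<bar>f r\<bar>)"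
  show "\<forall>s\<in>{b..<w}. f s \<noteq> 0"
  proof (intro ballI notI)
    fix s assume s: "s \<in> {b..<w}" and fs: "f s = 0"
    obtain q where q: "q \<in> \<rat>" "s < q" "q < w" using s Rats_dense_in_real[of s w] by auto
    then obtain n where n: "\<forall>r\<in>\<rat> \<inter> {b..q}. 1 / real (Suc n) \<le> \<bar>f r\<bar>"
      using bd s by fastforce
    obtain d where d: "d > 0" "\<And>r. r \<in> {0..} \<Longrightarrow> dist r s < d \<Longrightarrow> dist (f r) (f s) < 1 / real (Suc n)"
      using assms(1)[unfolded continuous_on_iff, rule_format, of s "1 / real (Suc n)"] assms(2) s
      by auto
    \<comment> \<open>Approaching \<open>s\<close> from the right keeps \<open>r\<close> inside
      \<open>{b..q}\<close> even when \<open>s = b\<close>; this is why \<open>q\<close> was taken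
      strictly beyond \<open>s\<close>.\<close>
    obtain r where r: "r \<in> \<rat>" "s < r" "r < min (s + d) q"
      using Rats_dense_in_real[of s "min (s + d) q"] d(1) q by auto
    have "\<bar>f r\<bar> < 1 / real (Suc n)"
      using d(2)[of r] r s fs assms(2) by (auto simp: dist_real_def)
    moreover have "1 / real (Suc n) \<le> \<bar>f r\<bar>" using n r s by auto
    ultimately show False by linarith
  qed
qed

section \<open>Running maximum and last zero as measurable functionals of the path\<close>

lemma abs_le_max_abs:
  assumes "continuous_on {0..} (\<lambda>s. X s \<omega>)" and "z \<in> {0..t}"
  shows "\<bar>X z \<omega>\<bar> \<le> max_abs X t \<omega>"
  unfolding max_abs_def
proof (rule cSUP_upper[OF assms(2)])
  have "compact ((\<lambda>z. \<bar>X z \<omega>\<bar>) ` {0..t})"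
    by (intro compact_continuous_image continuous_intros continuous_on_subset[OF assms(1)]) auto
  then show "bdd_above ((\<lambda>z. \<bar>X z \<omega>\<bar>) ` {0..t})"
    by (simp add: compact_imp_bounded bounded_imp_bdd_above)
qed

text \<open>Countably many coordinates determine the maximum, which makes it a measurable
  functional of the path.  The extended reals absorb unbounded elements of the path space.\<close>

definition rational_max_abs :: "real \<Rightarrow> (real \<Rightarrow> real) \<Rightarrow> real" where
  "rational_max_abs t x = real_of_ereal (SUP q\<in>\<rat> \<inter> {0..1}. ereal \<bar>x (q * t)\<bar>)"

lemma rational_max_abs_measurable:
  assumes "0 \<le> t"
  shows "rational_max_abs t \<in> borel_measurable (\<Pi>\<^sub>M s\<in>{0..}. borel)"
proof -
  have "(\<lambda>x. x (q * t)) \<in> borel_measurable (\<Pi>\<^sub>M s\<in>{0..}. (borel :: real measure))"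
    if "q \<in> \<rat> \<inter> {0..1}" for q
    using that assms by (intro measurable_component_singleton) auto
  then show ?thesis
    unfolding rational_max_abs_def
    by (intro borel_measurable_real_of_ereal borel_measurable_SUP borel_measurable_ereal
        borel_measurable_abs) (auto intro: countable_subset[OF _ countable_rat])
qed

text \<open>By continuity the supremum over \<open>{0..t}\<close> is already reached along a dense
  set of times. Rational multiples \<open>q * t\<close> are used instead of rational times, so that
  an irrational \<open>t\<close> requires no separate treatment.\<close>

lemma max_abs_eq_rational_max_abs:
  assumes "continuous_on {0..} (\<lambda>s. X s \<omega>)" and "0 < t"
  shows "max_abs X t \<omega> = rational_max_abs t (\<lambda>s\<in>{0..}. X s \<omega>)"
proof -
  let ?S = "SUP q\<in>\<rat> \<inter> {0..1}. ereal \<bar>(\<lambda>s\<in>{0..}. X s \<omega>) (q * t)\<bar>"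
  have "?S = ereal (max_abs X t \<omega>)"
  proof (rule antisym)
    show "?S \<le> ereal (max_abs X t \<omega>)"
      using assms by (intro SUP_least) (auto intro!: abs_le_max_abs mult_left_le_one_le)
  next
    have low: "ereal \<bar>X (q * t) \<omega>\<bar> \<le> ?S" if "q \<in> \<rat> \<inter> {0..1}" for q
      using that assms(2) by (intro SUP_upper2[of q]) auto
    show "ereal (max_abs X t \<omega>) \<le> ?S"
    proof (rule ccontr)
      assume "\<not> ?thesis"
      then have lt: "?S < ereal (max_abs X t \<omega>)" by simp
      \<comment> \<open>Squeezed between two reals, the extended supremum is itself a real
        \<open>c\<close>, and the contradiction can be derived in real arithmetic.\<close>
      have finite: "\<exists>c. S = ereal c" if "ereal u \<le> S" "S < ereal v" for S u v
        using that by (cases S) auto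
      obtain c where c: "?S = ereal c" using finite[OF low lt, of 0] by auto
      have "continuous_on {0..t} (\<lambda>z. \<bar>X z \<omega>\<bar>)"
        by (intro continuous_intros continuous_on_subset[OF assms(1)]) auto
      moreover have "\<not> (\<forall>z\<in>{0..t}. \<bar>X z \<omega>\<bar> \<le> c)"
      proof
        assume "\<forall>z\<in>{0..t}. \<bar>X z \<omega>\<bar> \<le> c"
        then have "max_abs X t \<omega> \<le> c"
          unfolding max_abs_def using assms(2) by (intro cSUP_least) auto
        then show False using lt c by simp
      qed
      then obtain z where z: "z \<in> {0..t}" "c < \<bar>X z \<omega>\<bar>" by (auto simp: not_le)
      ultimately obtain d where d: "d > 0"
          "\<And>y. y \<in> {0..t} \<Longrightarrow> dist y z < d \<Longrightarrow> dist \<bar>X y \<omega>\<bar> \<bar>X z \<omega>\<bar> < \<bar>X z \<omega>\<bar> - c"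
        unfolding continuous_on_iff by (metis diff_gt_0_iff_gt)
      \<comment> \<open>The part of the \<open>d\<close>-neighbourhood of \<open>z\<close> inside
        \<open>{0..t}\<close> contains an open interval even if \<open>z\<close> is an endpoint;
        rescaled by \<open>t\<close> it yields a rational \<open>q\<close>. There the path would
        exceed \<open>c\<close> in absolute value.\<close>
      have "max 0 (z - d) / t < min t (z + d) / t"
        using z d(1) assms(2) by (intro divide_strict_right_mono) auto
      then obtain q where q: "q \<in> \<rat>" "max 0 (z - d) / t < q" "q < min t (z + d) / t"
        using Rats_dense_in_real by blast
      then have qt: "max 0 (z - d) < q * t" "q * t < min t (z + d)"
        using assms(2) by (simp_all add: pos_divide_less_eq pos_less_divide_eq)
      then have "0 \<le> q" "q \<le> 1"
        using assms(2) by (auto simp: zero_less_mult_iff)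
      have "\<bar>X (q * t) \<omega>\<bar> \<le> c" using low[of q] q(1) \<open>0 \<le> q\<close> \<open>q \<le> 1\<close> c by auto
      moreover have "dist \<bar>X (q * t) \<omega>\<bar> \<bar>X z \<omega>\<bar> < \<bar>X z \<omega>\<bar> - c"
        by (rule d(2)) (use qt \<open>q \<le> 1\<close> in \<open>auto simp: dist_real_def abs_less_iff\<close>)
      ultimately show False by (simp add: dist_real_def)
    qed
  qed
  then show ?thesis by (simp add: rational_max_abs_def)
qed

text \<open>By compactness of the intervals \<open>{b..q}\<close>, the absence of zeros on \<open>{b..<w}\<close> is a condition on
  countably many coordinates.\<close>

definition last_zero_less_set :: "real \<Rightarrow> ((real \<Rightarrow> real) \<times> real) set" where
  "last_zero_less_set a = {p \<in> space ((\<Pi>\<^sub>M s\<in>{0..}. borel) \<Otimes>\<^sub>M borel). a \<le> snd p \<and>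
     (\<exists>b\<in>\<rat> \<inter> {0<..<a}. \<forall>q\<in>\<rat> \<inter> {b<..}. q < snd p \<longrightarrow>
       (\<exists>n. \<forall>r\<in>\<rat> \<inter> {b..q}. 1 / real (Suc n) \<le> \<bar>fst p r\<bar>))}"

text \<open>All quantifiers range over countable sets, and \<open>r \<ge> b > 0\<close> ensures that
  each condition on the path reads a coordinate in the index set.\<close>

lemma last_zero_less_set_measurable:
  "last_zero_less_set a \<in> sets ((\<Pi>\<^sub>M s\<in>{0..}. borel) \<Otimes>\<^sub>M borel)"
proof -
  let ?N = "(\<Pi>\<^sub>M s\<in>{0..}. borel) \<Otimes>\<^sub>M borel :: ((real \<Rightarrow> real) \<times> real) measure"
  have coord [measurable]: "(\<lambda>p. fst p r) \<in> borel_measurable ?N" if "0 \<le> r" for r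
    using that by (intro measurable_compose[OF measurable_fst measurable_component_singleton]) auto
  have *: "{p \<in> space ?N. 1 / real (Suc n) \<le> \<bar>fst p r\<bar>} \<in> sets ?N" if "0 \<le> r" for r n
    using coord[OF that] by measurable
  have [simp]: "countable (\<rat> \<inter> A)" for A :: "real set"
    by (rule countable_subset[OF _ countable_rat]) auto
  show ?thesis
    unfolding last_zero_less_set_def
    by (intro sets.sets_Collect_conj sets.sets_Collect_countable_Ex'
        sets.sets_Collect_countable_All' sets.sets_Collect_imp sets.sets_Collect_countable_Ex
        sets.sets_Collect_countable_Ball sets.sets_Collect_countable_Bex *) (simp; measurable)+
qed

text \<open>Combines the two rational characterisations. Restricting the path to
  \<open>{0..}\<close> places it in the product space without affecting the times \<open>r\<close>
  that are inspected.\<close>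

lemma last_zero_before_less_iff_mem:
  assumes "continuous_on {0..} (\<lambda>s. X s \<omega>)" and "X 0 \<omega> = 0" and "0 < a" and "a \<le> w"
  shows "last_zero_before X w \<omega> < a \<longleftrightarrow> ((\<lambda>s\<in>{0..}. X s \<omega>), w) \<in> last_zero_less_set a"
proof -
  have nz: "(\<forall>s\<in>{b..<w}. X s \<omega> \<noteq> 0) \<longleftrightarrow> (\<forall>q\<in>\<rat> \<inter> {b<..}. q < w \<longrightarrow>
       (\<exists>n. \<forall>r\<in>\<rat> \<inter> {b..q}. 1 / real (Suc n) \<le> \<bar>(\<lambda>s\<in>{0..}. X s \<omega>) r\<bar>))"
    if "0 < b" for b
    using nonvanishing_iff_bounded_on_rationals[OF assms(1), of b w] that by auto
  have "last_zero_before X w \<omega> < a \<longleftrightarrow> (\<exists>b\<in>\<rat> \<inter> {0<..<a}. \<forall>s\<in>{b..<w}. X s \<omega> \<noteq> 0)"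
    unfolding last_zero_before_less_iff[of X, OF assms(2-4)]
    by (simp only: Bex_def Int_iff greaterThanLessThan_iff conj_assoc)
  also have "\<dots> \<longleftrightarrow> (\<exists>b\<in>\<rat> \<inter> {0<..<a}. \<forall>q\<in>\<rat> \<inter> {b<..}. q < w \<longrightarrow>
       (\<exists>n. \<forall>r\<in>\<rat> \<inter> {b..q}. 1 / real (Suc n) \<le> \<bar>(\<lambda>s\<in>{0..}. X s \<omega>) r\<bar>))"
    by (intro bex_cong refl nz) auto
  also have "\<dots> \<longleftrightarrow> ((\<lambda>s\<in>{0..}. X s \<omega>), w) \<in> last_zero_less_set a"
    using assms(4) by (simp add: last_zero_less_set_def space_pair_measure space_PiM)
  finally show ?thesis .
qed

section \<open>Independence and conditioning on the level\<close>

text \<open>The product law of the two paths is pushed forward by the identity in the first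
  coordinate and \<open>rational_max_abs t\<close> in the second. The first path is kept whole
  because its last zero before a varying level depends on all of it.\<close>

lemma (in prob_space) indep_processes_joint_distr:
  fixes X Y :: "real \<Rightarrow> 'a \<Rightarrow> real"
  assumes indep: "indep_processes M X Y"
    and cont: "\<And>\<omega>. \<omega> \<in> space M \<Longrightarrow> continuous_on {0..} (\<lambda>s. Y s \<omega>)" and t: "0 < t"
  defines "P \<equiv> (\<Pi>\<^sub>M s\<in>{0::real..}. (borel :: real measure))"
    and "\<xi> \<equiv> (\<lambda>\<omega>. \<lambda>s\<in>{0..}. X s \<omega>)"
  shows "\<xi> \<in> measurable M P" and "max_abs Y t \<in> borel_measurable M"
    and "distr M P \<xi> \<Otimes>\<^sub>M distr M borel (max_abs Y t)
      = distr M (P \<Otimes>\<^sub>M borel) (\<lambda>\<omega>. (\<xi> \<omega>, max_abs Y t \<omega>))"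
proof -
  define \<eta> where "\<eta> \<omega> = (\<lambda>s\<in>{0..}. Y s \<omega>)" for \<omega>
  have "indep_var P \<xi> P \<eta>"
    using indep unfolding indep_processes_def P_def \<xi>_def \<eta>_def .
  then have \<xi>m [measurable]: "\<xi> \<in> measurable M P"
    and \<eta>m [measurable]: "\<eta> \<in> measurable M P"
    and indep: "distr M P \<xi> \<Otimes>\<^sub>M distr M P \<eta> = distr M (P \<Otimes>\<^sub>M P) (\<lambda>\<omega>. (\<xi> \<omega>, \<eta> \<omega>))"
    using indep_var_distribution_eq by auto
  have rm [measurable]: "rational_max_abs t \<in> borel_measurable P"
    using rational_max_abs_measurable[of t] t by (simp add: P_def)
  have W_eq: "max_abs Y t \<omega> = rational_max_abs t (\<eta> \<omega>)" if "\<omega> \<in> space M" for \<omega>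
    using max_abs_eq_rational_max_abs[of Y, OF cont[OF that] t] by (simp add: \<eta>_def)
  have "(\<lambda>\<omega>. rational_max_abs t (\<eta> \<omega>)) \<in> borel_measurable M" by measurable
  then show Wm [measurable]: "max_abs Y t \<in> borel_measurable M"
    using W_eq by (simp cong: measurable_cong)
  have W_distr: "distr M borel (max_abs Y t) = distr (distr M P \<eta>) borel (rational_max_abs t)"
    using W_eq by (simp add: distr_distr comp_def cong: distr_cong)
  have "prob_space (distr M borel (max_abs Y t))" by (rule prob_space_distr) measurable
  then have "sigma_finite_measure (distr (distr M P \<eta>) borel (rational_max_abs t))"
    unfolding W_distr by (rule prob_space_imp_sigma_finite)
  \<comment> \<open>Writing the first factor as an image under the identity gives the product the
    form required by \<open>pair_measure_distr\<close>.\<close>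
  then have "distr (distr M P \<xi>) P (\<lambda>x. x) \<Otimes>\<^sub>M distr (distr M P \<eta>) borel (rational_max_abs t)
      = distr (distr M (P \<Otimes>\<^sub>M P) (\<lambda>\<omega>. (\<xi> \<omega>, \<eta> \<omega>))) (P \<Otimes>\<^sub>M borel)
          (\<lambda>(x, y). (x, rational_max_abs t y))"
    unfolding indep[symmetric] by (intro pair_measure_distr) auto
  also have "\<dots> = distr M (P \<Otimes>\<^sub>M borel) (\<lambda>\<omega>. (\<xi> \<omega>, max_abs Y t \<omega>))"
    using W_eq by (simp add: distr_distr comp_def cong: distr_cong)
  finally show "distr M P \<xi> \<Otimes>\<^sub>M distr M borel (max_abs Y t)
      = distr M (P \<Otimes>\<^sub>M borel) (\<lambda>\<omega>. (\<xi> \<omega>, max_abs Y t \<omega>))"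
    by (simp add: W_distr distr_distr comp_def)
  show "\<xi> \<in> measurable M P" by (fact \<xi>m)
qed

text \<open>By \<open>joint\<close>, the probability of \<open>E\<close> is a product measure, so
  Fubini allows integrating over the path first with the level \<open>w\<close> frozen. The section
  at a frozen level is an event about the last zero before a deterministic time.\<close>

lemma (in prob_space) prob_last_zero_less_set:
  fixes X :: "real \<Rightarrow> 'a \<Rightarrow> real"
  assumes X0: "\<And>\<omega>. \<omega> \<in> space M \<Longrightarrow> X 0 \<omega> = 0"
    and Xc: "\<And>\<omega>. \<omega> \<in> space M \<Longrightarrow> continuous_on {0..} (\<lambda>s. X s \<omega>)" and a: "0 < a"
  defines "P \<equiv> (\<Pi>\<^sub>M s\<in>{0::real..}. (borel :: real measure))"
    and "\<xi> \<equiv> (\<lambda>\<omega>. \<lambda>s\<in>{0..}. X s \<omega>)"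
  assumes \<xi>m [measurable]: "\<xi> \<in> measurable M P" and Wm [measurable]: "W \<in> borel_measurable M"
    and joint: "distr M P \<xi> \<Otimes>\<^sub>M distr M borel W = distr M (P \<Otimes>\<^sub>M borel) (\<lambda>\<omega>. (\<xi> \<omega>, W \<omega>))"
  defines "E \<equiv> {\<omega> \<in> space M. (\<xi> \<omega>, W \<omega>) \<in> last_zero_less_set a}"
  shows "E \<in> events"
    and "prob E = (LINT w:{a..}|distr M borel W. \<P>(\<omega> in M. last_zero_before X w \<omega> < a))"
proof -
  note G_meas = last_zero_less_set_measurable[of a, folded P_def]
  have pairm [measurable]: "(\<lambda>\<omega>. (\<xi> \<omega>, W \<omega>)) \<in> measurable M (P \<Otimes>\<^sub>M borel)" by measurable
  interpret P1: prob_space "distr M P \<xi>" by (rule prob_space_distr) measurable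
  interpret P2: prob_space "distr M borel W" by (rule prob_space_distr) measurable
  interpret PP: pair_prob_space "distr M P \<xi>" "distr M borel W" ..

  have E_vimage: "E = (\<lambda>\<omega>. (\<xi> \<omega>, W \<omega>)) -` last_zero_less_set a \<inter> space M"
    by (auto simp: E_def)
  show "E \<in> events" unfolding E_vimage using pairm G_meas by (rule measurable_sets)

  have "prob E = measure (distr M P \<xi> \<Otimes>\<^sub>M distr M borel W) (last_zero_less_set a)"
    unfolding joint using G_meas by (simp add: measure_distr E_vimage)
  also have "\<dots> = (\<integral>p. indicator (last_zero_less_set a) p \<partial>(distr M P \<xi> \<Otimes>\<^sub>M distr M borel W))"
    using sets.sets_into_space[OF G_meas]
    by (simp add: space_pair_measure Int_absorb2)
  also have "\<dots> = (\<integral>w. (\<integral>x. indicator (last_zero_less_set a) (x, w) \<partial>distr M P \<xi>) \<partial>distr M borel W)"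
  proof (rule PP.integral_snd[symmetric, of "\<lambda>x w. indicator (last_zero_less_set a) (x, w)", simplified])
    show "integrable (distr M P \<xi> \<Otimes>\<^sub>M distr M borel W)
        (indicator (last_zero_less_set a) :: _ \<Rightarrow> real)"
      using G_meas by (intro integrable_real_indicator) (auto simp: PP.emeasure_eq_measure)
  qed
  also have "\<dots> = (LINT w:{a..}|distr M borel W. \<P>(\<omega> in M. last_zero_before X w \<omega> < a))"
    unfolding set_lebesgue_integral_def
  proof (rule Bochner_Integration.integral_cong[OF refl])
    fix w :: real
    let ?S = "{x \<in> space P. (x, w) \<in> last_zero_less_set a}"
    have S: "?S \<in> sets P"
      using measurable_sets[OF measurable_Pair2'[of w borel P] G_meas]
      by (simp add: vimage_def Int_def conj_commute)
    have "(\<integral>x. indicator (last_zero_less_set a) (x, w) \<partial>distr M P \<xi>)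
        = (\<integral>x. indicator ?S x \<partial>distr M P \<xi>)"
      by (rule Bochner_Integration.integral_cong) (auto simp: indicator_def)
    also have "\<dots> = measure (distr M P \<xi>) ?S"
      using sets.sets_into_space[OF S] by (simp add: Int_absorb2)
    also have "\<dots> = prob {\<omega> \<in> space M. (\<xi> \<omega>, w) \<in> last_zero_less_set a}"
      using measurable_space[OF \<xi>m] S
      by (subst measure_distr) (auto intro!: arg_cong[where f = prob])
    also have "\<dots> = indicator {a..} w *\<^sub>R \<P>(\<omega> in M. last_zero_before X w \<omega> < a)"
    \<comment> \<open>Membership includes \<open>a \<le> w\<close>, so sections at lower levels are
      empty; this produces the integration domain \<open>{a..}\<close>.\<close>
    proof (cases "a \<le> w")
      case True
      then show ?thesis
        using last_zero_before_less_iff_mem[of X, OF Xc X0 a True]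
        by (auto simp: \<xi>_def intro!: arg_cong[where f = prob])
    next
      case False
      then have "{\<omega> \<in> space M. (\<xi> \<omega>, w) \<in> last_zero_less_set a} = {}"
        by (auto simp: last_zero_less_set_def)
      then show ?thesis using False by (simp only:) simp
    qed
    finally show "(\<integral>x. indicator (last_zero_less_set a) (x, w) \<partial>distr M P \<xi>)
        = indicator {a..} w *\<^sub>R \<P>(\<omega> in M. last_zero_before X w \<omega> < a)" .
  qed
  finally show
    "prob E = (LINT w:{a..}|distr M borel W. \<P>(\<omega> in M. last_zero_before X w \<omega> < a))" .
qed

section \<open>Decomposition of the event\<close>

text \<open>Isolates the path properties from the Gaussian law, which is later used to supply
  \<open>nonzero\<close>. Up to a null set the event is the disjoint union of \<open>A\<close> and
  \<open>E\<close>.\<close>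

lemma (in prob_space) prob_last_zero_before_max_less:
  fixes X Y :: "real \<Rightarrow> 'a \<Rightarrow> real"
  assumes indep: "indep_processes M X Y"
    and X0: "\<And>\<omega>. \<omega> \<in> space M \<Longrightarrow> X 0 \<omega> = 0"
    and Xc: "\<And>\<omega>. \<omega> \<in> space M \<Longrightarrow> continuous_on {0..} (\<lambda>s. X s \<omega>)"
    and Yc: "\<And>\<omega>. \<omega> \<in> space M \<Longrightarrow> continuous_on {0..} (\<lambda>s. Y s \<omega>)"
    and nonzero: "AE \<omega> in M. Y t \<omega> \<noteq> 0"
    and t: "0 < t" and a: "0 < a"
  shows "\<P>(\<omega> in M. last_zero_before_max X Y t \<omega> < a)
       = \<P>(\<omega> in M. max_abs Y t \<omega> < a)
         + (LINT w:{a..}|distr M borel (max_abs Y t). \<P>(\<omega> in M. last_zero_before X w \<omega> < a))"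
proof -
  define W where "W = max_abs Y t"
  define E where "E = {\<omega> \<in> space M. ((\<lambda>s\<in>{0..}. X s \<omega>), W \<omega>) \<in> last_zero_less_set a}"
  define A where "A = {\<omega> \<in> space M. W \<omega> < a}"
  note J = indep_processes_joint_distr[OF indep Yc t, folded W_def]
  note [measurable] = J(2)
  have [measurable]: "E \<in> events" and
    E_prob: "prob E = (LINT w:{a..}|distr M borel W. \<P>(\<omega> in M. last_zero_before X w \<omega> < a))"
    unfolding E_def by (rule prob_last_zero_less_set[OF X0 Xc a J]; assumption)+
  have [measurable]: "A \<in> events" unfolding A_def by measurable

  have W_nonneg: "0 \<le> W \<omega>" and W_ge: "\<bar>Y t \<omega>\<bar> \<le> W \<omega>" if "\<omega> \<in> space M" for \<omega>
    using abs_le_max_abs[of Y, OF Yc[OF that], of 0 t] abs_le_max_abs[of Y, OF Yc[OF that], of t t]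
      t by (auto simp: W_def)
  have W_pos: "AE \<omega> in M. 0 < W \<omega>"
    using nonzero
    by (rule AE_mp, intro AE_I2) (use W_ge in force)

  let ?T = "last_zero_before_max X Y t"
  have T_eq: "?T \<omega> = last_zero_before X (W \<omega>) \<omega>" for \<omega>
    by (simp add: last_zero_before_max_def last_zero_before_def W_def)
  have T_large: "?T \<omega> < a \<longleftrightarrow> \<omega> \<in> E" if "\<omega> \<in> space M" "a \<le> W \<omega>" for \<omega>
    using last_zero_before_less_iff_mem[of X, OF Xc X0 a] that
    by (auto simp: T_eq E_def)
  \<comment> \<open>Positivity of \<open>W\<close> puts time 0 into the set of zeros, so
    \<open>cSup_least\<close> applies with the bound \<open>W\<close>.\<close>
  have T_small: "?T \<omega> < a" if "\<omega> \<in> space M" "0 < W \<omega>" "W \<omega> < a" for \<omega>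
  proof -
    have "?T \<omega> \<le> W \<omega>"
      unfolding T_eq last_zero_before_def
      using X0[OF that(1)] that by (intro cSup_least) auto
    then show ?thesis using that by simp
  qed
  \<comment> \<open>The set of zeros is empty here, so nothing is known about the value except that it is constant.\<close>
  have T_zero: "?T \<omega> = Sup {}" if "W \<omega> = 0" for \<omega>
    unfolding T_eq last_zero_before_def using that by (intro arg_cong[where f = Sup]) auto
  have disj: "A \<inter> E = {}" by (auto simp: A_def E_def last_zero_less_set_def)
  \<comment> \<open>This exact identity, including the null piece, serves to prove measurability:
    \<open>M\<close> is not assumed complete, so almost sure equality with
    \<open>A \<union> E\<close> would not suffice. The last piece is either all of
    \<open>W = 0\<close> or empty.\<close>
  have "{\<omega> \<in> space M. ?T \<omega> < a}
      = {\<omega> \<in> space M. 0 < W \<omega> \<and> W \<omega> < a} \<union> E \<union> {\<omega> \<in> space M. W \<omega> = 0 \<and> Sup {} < a}"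
    (is "?L = ?R")
  proof (rule set_eqI)
    fix \<omega>
    show "\<omega> \<in> ?L \<longleftrightarrow> \<omega> \<in> ?R"
    proof (cases "\<omega> \<in> space M")
      case True
      have "\<omega> \<in> E \<Longrightarrow> a \<le> W \<omega>" by (auto simp: E_def last_zero_less_set_def)
      then show ?thesis
        using True W_nonneg[OF True] T_large[OF True] T_small[OF True] T_zero[of \<omega>] a
        by (cases "a \<le> W \<omega>"; cases "W \<omega> = 0") auto
    qed (auto simp: E_def)
  qed
  also have "\<dots> \<in> events" by measurable
  finally have "prob ?L = prob (A \<union> E)"
  proof (rule measure_eq_AE[rotated])
    show "AE \<omega> in M. (\<omega> \<in> ?L) = (\<omega> \<in> A \<union> E)"
      using W_pos by (rule AE_mp, intro AE_I2)
        (use T_large T_small disj in \<open>force simp: A_def E_def not_less\<close>)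
  qed measurable
  also have "\<dots> = prob A + prob E" using disj by (intro finite_measure_Union) auto
  finally show ?thesis
    unfolding E_prob unfolding A_def W_def .
qed

section \<open>Application to Brownian motion with drift\<close>

lemma drifted_brownian_motion_paths:
  assumes "standard_brownian_motion M B" and "\<omega> \<in> space M"
  shows "with_drift \<mu> B 0 \<omega> = 0" and "continuous_on {0..} (\<lambda>s. with_drift \<mu> B s \<omega>)"
  using assms unfolding standard_brownian_motion_def with_drift_def
  by (auto intro!: continuous_intros)

text \<open>A zero at time \<open>t\<close> forces the increment \<open>B t - B 0\<close> to equal
  \<open>- (\<mu> * t)\<close>, a single value, which is null for a law with a density.\<close>

lemma drifted_brownian_motion_nonzero_AE:
  assumes "standard_brownian_motion M B" and "0 < t"
  shows "AE \<omega> in M. with_drift \<mu> B t \<omega> \<noteq> 0"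
proof -
  have "distributed M lborel (\<lambda>\<omega>. B t \<omega> - B 0 \<omega>) (normal_density 0 (sqrt (t - 0)))"
    using assms unfolding standard_brownian_motion_def by blast
  then have incr: "distr M lborel (\<lambda>\<omega>. B t \<omega> - B 0 \<omega>) = density lborel (normal_density 0 (sqrt t))"
    and [measurable]: "(\<lambda>\<omega>. B t \<omega> - B 0 \<omega>) \<in> borel_measurable M"
    by (auto simp: distributed_def)
  have "AE x in distr M lborel (\<lambda>\<omega>. B t \<omega> - B 0 \<omega>). x \<noteq> - (\<mu> * t)"
    unfolding incr using AE_lborel_singleton[of "- (\<mu> * t)"]
    by (subst AE_density) (measurable, rule AE_mp, auto)
  then have "AE \<omega> in M. B t \<omega> - B 0 \<omega> \<noteq> - (\<mu> * t)"
    by (rule AE_distrD[rotated]) measurable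
  then show ?thesis
    by (rule AE_mp, intro AE_I2 impI)
      (use assms(1) in \<open>auto simp: standard_brownian_motion_def with_drift_def\<close>)
qed

theorem mainTheorem6:
  fixes M :: "'a measure" and B\<^sub>1 B\<^sub>2 :: "real \<Rightarrow> 'a \<Rightarrow> real"
    and \<mu>\<^sub>1 \<mu>\<^sub>2 t a :: real
  assumes "prob_space M"
    and "standard_brownian_motion M B\<^sub>1"
    and "standard_brownian_motion M B\<^sub>2"
    and "indep_processes M (with_drift \<mu>\<^sub>1 B\<^sub>1) (with_drift \<mu>\<^sub>2 B\<^sub>2)"
    and "t > 0" and "a > 0"
  shows "\<P>(\<omega> in M. last_zero_before_max (with_drift \<mu>\<^sub>1 B\<^sub>1) (with_drift \<mu>\<^sub>2 B\<^sub>2) t \<omega> < a)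
       = \<P>(\<omega> in M. max_abs (with_drift \<mu>\<^sub>2 B\<^sub>2) t \<omega> < a)
         + (LINT w:{a..}|distr M borel (max_abs (with_drift \<mu>\<^sub>2 B\<^sub>2) t).
              \<P>(\<omega> in M. last_zero_before (with_drift \<mu>\<^sub>1 B\<^sub>1) w \<omega> < a))"
  using assms
  by (intro prob_space.prob_last_zero_before_max_less drifted_brownian_motion_nonzero_AE
      drifted_brownian_motion_paths)

end
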